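(* Let $X$ be an infinite Hausdorff space. Then the closure $\overline{\mathcal{O}_{cs}(X)}$ of $\mathcal{O}_{cs}(X)$ in $X$ is a totally disconnected subset of $X$ (that is, it is totally disconnected in the subspace topology).
   Context: For a Hausdorff space $X$, $\mathcal{F}(X)$ denotes the set of all nonempty closed subsets of $X$, endowed with the Vietoris topology, which is generated by all sets of the form $\langle\mathcal{V}\rangle=\{S\in\mathcal{F}(X): S\subseteq\bigcup\mathcal{V}\text{ and } S\cap V\neq\emptyset\text{ for all }V\in\mathcal{V}\}$, where $\mathcal{V}$ runs over the finite families of open subsets of $X$. A selection for $\mathcal{F}(X)$ is a map $f:\mathcal{F}(X)\to X$ with $f(S)\in S$ for every $S\in\mathcal{F}(X)$; it is continuous if it is continuous with respect to the Vietoris topology. Set $\mathcal{O}_{cs}(X)=\{f(X): f \text{ is a continuous selection for } \mathcal{F}(X)\}\subseteq X$ (this is empty if there are no continuous selections). A space $Y$ is totally disconnected if each singleton of $Y$ is an intersection of clopen subsets of $Y$ (equivalently, all quasi-components of $Y$ are singletons). *)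

theory Defs
  imports "HOL-Analysis.Analysis"
begin

definition nonempty_closed_sets :: "'a topology \<Rightarrow> 'a set set" where
  "nonempty_closed_sets X = {S. closedin X S \<and> S \<noteq> {}}"

definition vietoris_basic :: "'a topology \<Rightarrow> 'a set set \<Rightarrow> 'a set set" where
  "vietoris_basic X \<V> =
     {S \<in> nonempty_closed_sets X. S \<subseteq> \<Union>\<V> \<and> (\<forall>V\<in>\<V>. S \<inter> V \<noteq> {})}"

definition vietoris_topology :: "'a topology \<Rightarrow> 'a set topology" where
  "vietoris_topology X =
     topology_generated_by {vietoris_basic X \<V> | \<V>. finite \<V> \<and> (\<forall>V\<in>\<V>. openin X V)}"

lemma topspace_vietoris_topology [simp]:
  "topspace (vietoris_topology X) = nonempty_closed_sets X"
proof
  show "topspace (vietoris_topology X) \<subseteq> nonempty_closed_sets X"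
    by (auto simp: vietoris_topology_def vietoris_basic_def)
  have "S \<in> vietoris_basic X {topspace X}" if "S \<in> nonempty_closed_sets X" for S
    using that closedin_subset[of X S]
    by (auto simp: vietoris_basic_def nonempty_closed_sets_def)
  moreover have "finite {topspace X}" "\<forall>V\<in>{topspace X}. openin X V"
    by auto
  ultimately show "nonempty_closed_sets X \<subseteq> topspace (vietoris_topology X)"
    unfolding vietoris_topology_def topology_generated_by_topspace by blast
qed

text \<open>A selection is a total HOL function; only its values on nonempty closed sets matter.\<close>

definition selection :: "'a topology \<Rightarrow> ('a set \<Rightarrow> 'a) \<Rightarrow> bool" where
  "selection X f \<longleftrightarrow> (\<forall>S \<in> nonempty_closed_sets X. f S \<in> S)"

definition continuous_selection :: "'a topology \<Rightarrow> ('a set \<Rightarrow> 'a) \<Rightarrow> bool" where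
  "continuous_selection X f \<longleftrightarrow> selection X f \<and> continuous_map (vietoris_topology X) X f"

text \<open>
  The restriction to points of the space is automatic unless the space is empty; in that case
  the whole space is not a member of the hyperspace and \<open>f (topspace X)\<close> would be arbitrary.
\<close>

definition cs_points :: "'a topology \<Rightarrow> 'a set" where
  "cs_points X = {f (topspace X) | f. continuous_selection X f} \<inter> topspace X"

text \<open>
  Every singleton is an intersection of clopen sets. This is stronger than having only
  singletons as connected components.
\<close>

definition totally_disconnected_space :: "'a topology \<Rightarrow> bool" where
  "totally_disconnected_space Y \<longleftrightarrow>
     (\<forall>y \<in> topspace Y. \<exists>\<C>. (\<forall>C\<in>\<C>. openin Y C \<and> closedin Y C) \<and> \<Inter>\<C> = {y})"

end

theory Submission
  imports Defs
begin

text \<open>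
  A continuous selection \<open>f\<close> orders pairs by \<open>x <\<^sub>f y\<close> iff \<open>f {x, y} = x \<noteq> y\<close>. The relation need not be
  transitive, but its one-sided rays are open, so a point \<open>z\<close> cuts \<open>X - {z}\<close> into two open parts.

  Suppose \<open>p <\<^sub>f q\<close> lie in the closure \<open>Y\<close> of the set of selection points and no clopen subset of \<open>Y\<close>
  separates them. Cutting shows that \<open>(p, q)\<^sub>f\<close> is nonempty and contained in \<open>Y\<close> and in the
  quasi-component of \<open>p\<close> in \<open>X\<close>; so it contains some \<open>r = h(X)\<close>. Comparing the cuts of \<open>f\<close> at
  \<open>r\<close> with the order of \<open>h\<close> shows that \<open>r\<close> lies between \<open>p\<close> and \<open>q\<close> for \<open>h\<close> as well. By continuity
  there is a finite set \<open>F\<close> containing \<open>p\<close> and \<open>q\<close> such that \<open>s = h(F)\<close> is still between them. With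
  \<open>S = F - {s}\<close> and \<open>c = h(S)\<close>, the set \<open>G = {x. h(S \<union> {x}) = x}\<close> is closed and \<open>G - {c}\<close> is open, so the
  union of \<open>G\<close> with the closed ray at \<open>s\<close> that contains \<open>c\<close> is clopen. It separates \<open>s\<close> from \<open>p\<close> or
  from \<open>q\<close>, although all three lie in one quasi-component.
\<close>

section \<open>Cutting a space by a relation with open rays\<close>

locale cut_relation =
  fixes X :: "'a topology" and lt :: "'a \<Rightarrow> 'a \<Rightarrow> bool" (infix "\<lhd>" 50)
  assumes asym: "x \<lhd> y \<Longrightarrow> \<not> y \<lhd> x"
    and total: "\<lbrakk>x \<in> topspace X; y \<in> topspace X; x \<noteq> y\<rbrakk> \<Longrightarrow> x \<lhd> y \<or> y \<lhd> x"
    and open_below: "y \<in> topspace X \<Longrightarrow> openin X {x \<in> topspace X. x \<lhd> y}"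
    and open_above: "y \<in> topspace X \<Longrightarrow> openin X {x \<in> topspace X. y \<lhd> x}"
begin

lemma irrefl: "\<not> x \<lhd> x"
  using asym by blast

lemma dual: "cut_relation X (\<lambda>x y. y \<lhd> x)"
  by unfold_locales (use asym in blast, use total in blast, fact open_above, fact open_below)

lemma closed_atmost:
  assumes "y \<in> topspace X"
  shows "closedin X {x \<in> topspace X. x = y \<or> x \<lhd> y}"
proof -
  have "topspace X - {x \<in> topspace X. x = y \<or> x \<lhd> y} = {x \<in> topspace X. y \<lhd> x}"
    using total[OF _ assms] asym irrefl by auto
  then show ?thesis
    unfolding closedin_def using open_above[OF assms] by auto
qed

lemma closed_atleast:
  assumes "y \<in> topspace X"
  shows "closedin X {x \<in> topspace X. x = y \<or> y \<lhd> x}"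
  using cut_relation.closed_atmost[OF dual assms] .

text \<open>With nothing strictly between, the open ray below \<open>q\<close> would also be closed,
  and it separates \<open>p\<close> from \<open>q\<close>.\<close>

lemma quasi_component_between_nonempty:
  assumes Q: "quasi_component_of X p q" and "p \<lhd> q"
  obtains z where "z \<in> topspace X" "p \<lhd> z" "z \<lhd> q"
proof -
  have pq: "p \<in> topspace X" "q \<in> topspace X"
    using Q by (auto simp: quasi_component_of_def)
  let ?D = "{x \<in> topspace X. x \<lhd> q}"
  have "\<exists>z \<in> topspace X. p \<lhd> z \<and> z \<lhd> q"
  proof (rule ccontr)
    assume none: "\<not> ?thesis"
    \<comment> \<open>Without transitivity the closed ray at \<open>p\<close> may leave
      \<open>?D\<close>, hence the intersection with the closed ray at \<open>q\<close>.\<close>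
    have "?D = {x \<in> topspace X. x = p \<or> x \<lhd> p} \<inter> {x \<in> topspace X. x = q \<or> x \<lhd> q}"
    proof (intro set_eqI iffI)
      fix x assume "x \<in> ?D"
      then show "x \<in> {x \<in> topspace X. x = p \<or> x \<lhd> p} \<inter> {x \<in> topspace X. x = q \<or> x \<lhd> q}"
        using none total[of x p] pq by auto
    next
      fix x assume "x \<in> {x \<in> topspace X. x = p \<or> x \<lhd> p} \<inter> {x \<in> topspace X. x = q \<or> x \<lhd> q}"
      then show "x \<in> ?D"
        using asym[OF \<open>p \<lhd> q\<close>] \<open>p \<lhd> q\<close> by auto
    qed
    then have "closedin X ?D"
      by (simp only: closedin_Int closed_atmost pq)
    then have "p \<in> ?D \<longleftrightarrow> q \<in> ?D"
      using Q open_below[OF pq(2)] unfolding quasi_component_of_def by blast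
    then show False
      using pq \<open>p \<lhd> q\<close> irrefl by blast
  qed
  then show thesis using that by blast
qed

text \<open>If a clopen \<open>H\<close> contained \<open>r\<close> but not \<open>p\<close>,
  removing it from the ray below \<open>r\<close> would remove the only boundary point and leave a
  clopen set that contains \<open>p\<close> but not \<open>q\<close>.\<close>

lemma quasi_component_of_between:
  assumes Q: "quasi_component_of X p q" and r: "r \<in> topspace X" "p \<lhd> r" "r \<lhd> q"
  shows "quasi_component_of X p r"
proof -
  have pq: "p \<in> topspace X" "q \<in> topspace X"
    using Q by (auto simp: quasi_component_of_def)
  have *: "r \<notin> H" if H: "closedin X H" "openin X H" "p \<notin> H" for H
  proof
    assume "r \<in> H"
    let ?K = "{x \<in> topspace X. x \<lhd> r} - H"
    have "?K = {x \<in> topspace X. x = r \<or> x \<lhd> r} - H"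
      using \<open>r \<in> H\<close> by auto
    then have "closedin X ?K"
      by (simp only: closedin_diff closed_atmost r(1) H(2))
    moreover have "openin X ?K"
      using open_below r(1) H(1) by (simp add: openin_diff)
    ultimately have "p \<in> ?K \<longleftrightarrow> q \<in> ?K"
      using Q unfolding quasi_component_of_def by blast
    then show False
      using pq r asym H(3) by blast
  qed
  have "r \<in> H" if H: "closedin X H" "openin X H" "p \<in> H" for H
    using *[of "topspace X - H"] H r(1) by (auto simp: closedin_diff openin_diff)
  then show ?thesis
    using * pq r(1) unfolding quasi_component_of_def by blast
qed

text \<open>The ray below \<open>z\<close> has clopen trace on \<open>Y\<close> because
  \<open>z\<close> itself is missing. This forces intervals into the closure of the selection
  points.\<close>

lemma cut_subtopology:
  assumes "z \<in> topspace X" "z \<notin> Y" "p \<lhd> z" "z \<lhd> q"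
  shows "\<not> quasi_component_of (subtopology X Y) p q"
proof
  assume Q: "quasi_component_of (subtopology X Y) p q"
  let ?K = "Y \<inter> {x \<in> topspace X. x \<lhd> z}"
  have "?K = Y \<inter> {x \<in> topspace X. x = z \<or> x \<lhd> z}"
    using assms(2) by auto
  then have "closedin (subtopology X Y) ?K"
    by (simp only: closedin_subtopology_Int_closed closed_atmost assms(1))
  moreover have "openin (subtopology X Y) ?K"
    using open_below assms(1) by (simp add: openin_subtopology_Int2)
  ultimately have "p \<in> ?K \<longleftrightarrow> q \<in> ?K"
    using Q unfolding quasi_component_of_def by blast
  then show False
    using Q assms asym by (auto simp: quasi_component_of_def)
qed

text \<open>\<open>G\<close> can fail to be open only at \<open>c\<close>, and the closed ray at
  \<open>s\<close> only at \<open>s\<close>. Each set covers the bad point of the other, so their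
  union is clopen; it contains \<open>s\<close> but not \<open>p\<close>.\<close>

lemma cut_closed_open:
  assumes "closedin X G" "openin X (G - {c})" "s \<in> G" "p \<notin> G" "c \<in> topspace X" "s \<lhd> c" "p \<lhd> s"
  shows "\<not> quasi_component_of X p s"
proof
  assume Q: "quasi_component_of X p s"
  then have ps: "p \<in> topspace X" "s \<in> topspace X"
    by (auto simp: quasi_component_of_def)
  let ?K = "G \<union> {x \<in> topspace X. x = s \<or> s \<lhd> x}"
  have "?K = (G - {c}) \<union> {x \<in> topspace X. s \<lhd> x}"
    using assms irrefl by auto
  then have "openin X ?K"
    by (simp only: openin_Un open_above ps(2) assms(2))
  moreover have "closedin X ?K"
    by (simp only: closedin_Un closed_atleast ps(2) assms(1))
  ultimately have "p \<in> ?K \<longleftrightarrow> s \<in> ?K"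
    using Q unfolding quasi_component_of_def by blast
  then show False
    using assms asym irrefl by blast
qed

end

section \<open>Comparing two cut relations on one quasi-component\<close>

lemma cut_relation_compare:
  fixes lt lt' :: "'a \<Rightarrow> 'a \<Rightarrow> bool"
  assumes "cut_relation X lt" "cut_relation X lt'"
    and Q: "quasi_component_of X p r" and "q \<in> topspace X" "lt p r" "lt r q" "lt' r q"
  shows "lt' p q"
proof -
  interpret A: cut_relation X lt by fact
  interpret B: cut_relation X lt' by fact
  have pr: "p \<in> topspace X" "r \<in> topspace X"
    using Q by (auto simp: quasi_component_of_def)
  \<comment> \<open>The boundary point \<open>r\<close> of one ray lies inside the other, and so
    does \<open>q\<close>; thus the union is clopen. It contains \<open>r\<close>, hence
    \<open>p\<close>, which can only lie in the first ray.\<close>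
  let ?K = "{x \<in> topspace X. lt' x q} \<union> {x \<in> topspace X. x = r \<or> lt r x}"
  have "?K = {x \<in> topspace X. lt' x q} \<union> {x \<in> topspace X. lt r x}"
    using \<open>lt' r q\<close> by auto
  then have "openin X ?K"
    by (simp only: openin_Un A.open_above pr B.open_below \<open>q \<in> topspace X\<close>)
  moreover have "?K = {x \<in> topspace X. x = q \<or> lt' x q} \<union> {x \<in> topspace X. x = r \<or> lt r x}"
    using \<open>lt r q\<close> by auto
  then have "closedin X ?K"
    by (simp only: closedin_Un A.closed_atleast pr B.closed_atmost \<open>q \<in> topspace X\<close>)
  ultimately have "p \<in> ?K \<longleftrightarrow> r \<in> ?K"
    using Q unfolding quasi_component_of_def by blast
  then show ?thesis
    using pr A.asym A.irrefl \<open>lt p r\<close> by blast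
qed

text \<open>Comparison once with \<open>lt\<close> and once with its reverse puts \<open>p\<close>
  and \<open>q\<close> below each other for \<open>lt'\<close>.\<close>

lemma cut_relation_not_below_both:
  fixes lt lt' :: "'a \<Rightarrow> 'a \<Rightarrow> bool"
  assumes A: "cut_relation X lt" and B: "cut_relation X lt'"
    and Q: "quasi_component_of X p q" and "r \<in> topspace X" "lt p r" "lt r q"
    and "lt' r p" "lt' r q"
  shows False
proof -
  have pr: "quasi_component_of X p r"
    using cut_relation.quasi_component_of_between[OF A Q] assms by blast
  have qr: "quasi_component_of X q r"
    using Q pr by (meson quasi_component_of_sym quasi_component_of_trans)
  have pq: "p \<in> topspace X" "q \<in> topspace X"
    using Q by (auto simp: quasi_component_of_def)
  have "lt' p q"
    using cut_relation_compare[OF A B pr] pq assms by blast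
  moreover have "lt' q p"
    using cut_relation_compare[OF cut_relation.dual[OF A] B qr] pq assms by blast
  ultimately show False
    using cut_relation.asym[OF B] by blast
qed

lemma cut_relation_between:
  fixes lt lt' :: "'a \<Rightarrow> 'a \<Rightarrow> bool"
  assumes A: "cut_relation X lt" and B: "cut_relation X lt'"
    and Q: "quasi_component_of X p q" and r: "r \<in> topspace X" "lt p r" "lt r q"
  shows "lt' p r \<and> lt' r q \<or> lt' q r \<and> lt' r p"
proof -
  have pq: "p \<in> topspace X" "q \<in> topspace X"
    using Q by (auto simp: quasi_component_of_def)
  have "p \<noteq> r" "q \<noteq> r"
    using r cut_relation.irrefl[OF A] by auto
  then show ?thesis
    using cut_relation_not_below_both[OF A B Q r]
      cut_relation_not_below_both[OF A cut_relation.dual[OF B] Q r]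
      cut_relation.total[OF B] pq r(1) by meson
qed

section \<open>Quasi-components and the Vietoris topology\<close>

lemma totally_disconnected_spaceI:
  assumes "\<And>x y. quasi_component_of Y x y \<Longrightarrow> x = y"
  shows "totally_disconnected_space Y"
  unfolding totally_disconnected_space_def
proof
  fix y assume y: "y \<in> topspace Y"
  let ?C = "{C. openin Y C \<and> closedin Y C \<and> y \<in> C}"
  have "x = y" if x: "x \<in> \<Inter>?C" for x
  proof -
    have "x \<in> topspace Y"
      using x y by auto
    moreover have "x \<in> T \<longleftrightarrow> y \<in> T" if T: "closedin Y T" "openin Y T" for T
    proof (cases "y \<in> T")
      case False
      then have "topspace Y - T \<in> ?C"
        using T y by auto
      then show ?thesis using x False by blast
    qed (use x T in auto)
    ultimately show ?thesis
      using y assms unfolding quasi_component_of_def by blast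
  qed
  then have "\<Inter>?C = {y}" by blast
  then show "\<exists>\<C>. (\<forall>C\<in>\<C>. openin Y C \<and> closedin Y C) \<and> \<Inter>\<C> = {y}"
    by (intro exI[of _ ?C]) auto
qed

lemma insert_in_nonempty_closed_sets:
  assumes "Hausdorff_space X" "closedin X S" "x \<in> topspace X"
  shows "insert x S \<in> nonempty_closed_sets X"
  using closedin_Un[OF closedin_Hausdorff_singleton[OF assms(1,3)] assms(2)]
  by (simp add: nonempty_closed_sets_def)

lemma continuous_map_insert_vietoris:
  assumes "Hausdorff_space X" and S: "closedin X S"
  shows "continuous_map X (vietoris_topology X) (\<lambda>x. insert x S)"
  unfolding vietoris_topology_def
proof (rule continuous_on_generated_topo)
  note ins = insert_in_nonempty_closed_sets[OF assms]
  fix U assume "U \<in> {vietoris_basic X \<V> |\<V>. finite \<V> \<and> (\<forall>V\<in>\<V>. openin X V)}"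
  then obtain \<V> where \<V>: "U = vietoris_basic X \<V>" "finite \<V>" "\<forall>V\<in>\<V>. openin X V"
    by blast
  show "openin X ((\<lambda>x. insert x S) -` U \<inter> topspace X)"
  proof (cases "S \<subseteq> \<Union>\<V>")
    case True
    \<comment> \<open>Members of \<open>\<V>\<close> that already meet \<open>S\<close> impose
      nothing on \<open>x\<close>; each of the others must contain \<open>x\<close>.\<close>
    let ?\<W> = "insert (\<Union>\<V>) {V \<in> \<V>. S \<inter> V = {}}"
    have "insert x S \<in> U \<longleftrightarrow> x \<in> \<Inter>?\<W>" if "x \<in> topspace X" for x
      using True ins[OF that] by (auto simp: \<V>(1) vietoris_basic_def)
    then have "(\<lambda>x. insert x S) -` U \<inter> topspace X = topspace X \<inter> \<Inter>?\<W>"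
      by blast
    moreover have "openin X (\<Inter>?\<W>)"
    proof (rule openin_Inter)
      show "openin X V" if "V \<in> ?\<W>" for V
        using that \<V>(3) openin_Union[of \<V> X] by blast
    qed (use \<V>(2) in simp_all)
    ultimately show ?thesis
      by (simp only: openin_Int openin_topspace)
  next
    case False
    then have "(\<lambda>x. insert x S) -` U = {}"
      by (auto simp: \<V>(1) vietoris_basic_def)
    then show ?thesis by simp
  qed
next
  show "(\<lambda>x. insert x S) ` topspace X
    \<subseteq> \<Union>{vietoris_basic X \<V> |\<V>. finite \<V> \<and> (\<forall>V\<in>\<V>. openin X V)}"
    unfolding topology_generated_by_topspace[symmetric] vietoris_topology_def[symmetric]
    using insert_in_nonempty_closed_sets[OF assms] by auto
qed

text \<open>One point from each member of a basic neighbourhood of the whole space gives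
  \<open>F\<close>. It lets continuity at the whole space be tested on finite sets.\<close>

lemma openin_vietoris_contains_supersets:
  assumes "openin (vietoris_topology X) W" "topspace X \<in> W"
  shows "\<exists>F. finite F \<and> F \<subseteq> topspace X \<and> (\<forall>S \<in> nonempty_closed_sets X. F \<subseteq> S \<longrightarrow> S \<in> W)"
proof -
  let ?B = "{vietoris_basic X \<V> | \<V>. finite \<V> \<and> (\<forall>V\<in>\<V>. openin X V)}"
  have "generate_topology_on ?B W"
    using assms(1) by (simp add: vietoris_topology_def openin_topology_generated_by_iff)
  then show ?thesis
    using assms(2)
  proof induction
    case Empty
    then show ?case by simp
  next
    case (Int a b)
    then obtain F F' where "finite F" "F \<subseteq> topspace X" "\<forall>S \<in> nonempty_closed_sets X. F \<subseteq> S \<longrightarrow> S \<in> a"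
      "finite F'" "F' \<subseteq> topspace X" "\<forall>S \<in> nonempty_closed_sets X. F' \<subseteq> S \<longrightarrow> S \<in> b"
      by auto
    then show ?case
      by (intro exI[of _ "F \<union> F'"]) auto
  next
    case (UN K)
    then show ?case by (meson Union_iff)
  next
    case (Basis s)
    then obtain \<V> where \<V>: "s = vietoris_basic X \<V>" "finite \<V>"
      by blast
    then have V: "topspace X \<subseteq> \<Union>\<V>" "\<forall>V\<in>\<V>. \<exists>x. x \<in> topspace X \<inter> V"
      using Basis.prems by (auto simp: vietoris_basic_def)
    then obtain g where g: "\<And>V. V \<in> \<V> \<Longrightarrow> g V \<in> topspace X \<inter> V"
      by metis
    have "S \<in> s" if S: "S \<in> nonempty_closed_sets X" "g ` \<V> \<subseteq> S" for S
    proof -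
      have "S \<subseteq> topspace X"
        using S(1) closedin_subset by (auto simp: nonempty_closed_sets_def)
      then show ?thesis
        using S g V(1) unfolding \<V>(1) vietoris_basic_def by blast
    qed
    then show ?case
      using g \<V>(2) by (intro exI[of _ "g ` \<V>"]) auto
  qed
qed

section \<open>Selected points and the order of a selection\<close>

lemma
  assumes "Hausdorff_space X" and f: "continuous_selection X f"
    and S: "closedin X S" "S \<noteq> {}"
  defines "G \<equiv> {x \<in> topspace X. f (insert x S) = x}"
  shows closedin_selected_points: "closedin X G"
    and openin_selected_points: "openin X (G - {f S})"
proof -
  let ?g = "\<lambda>x. f (insert x S)"
  have g: "continuous_map X X ?g"
    using continuous_map_compose[OF continuous_map_insert_vietoris[OF assms(1) S(1)]] f
    unfolding continuous_selection_def o_def by blast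
  show "closedin X G"
    unfolding G_def using closedin_continuous_maps_eq[OF assms(1) g continuous_map_id] by simp
  have sel: "?g x = x \<or> ?g x \<in> S" if "x \<in> topspace X" for x
  proof -
    show ?thesis
      using insert_in_nonempty_closed_sets[OF assms(1) S(1) that] f
      unfolding continuous_selection_def selection_def by fast
  qed
  have "f S \<in> S"
    using f S unfolding continuous_selection_def selection_def nonempty_closed_sets_def by blast
  \<comment> \<open>On \<open>S\<close> the map \<open>?g\<close> is constantly \<open>f S\<close>,
    so \<open>G\<close> meets \<open>S\<close> only there. Off \<open>S\<close>, a point lies in
    \<open>G\<close> exactly when its value avoids \<open>S\<close>.\<close>
  then have "G - {f S} = (topspace X - S) \<inter> {x \<in> topspace X. ?g x \<in> topspace X - S}"
    using sel by (auto simp: G_def insert_absorb)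
  moreover have "openin X {x \<in> topspace X. ?g x \<in> topspace X - S}"
    using openin_continuous_map_preimage[OF g] S(1) by blast
  ultimately show "openin X (G - {f S})"
    using S(1) by (metis openin_Int openin_diff openin_topspace)
qed

definition selection_less :: "('a set \<Rightarrow> 'a) \<Rightarrow> 'a \<Rightarrow> 'a \<Rightarrow> bool" where
  "selection_less f x y \<longleftrightarrow> x \<noteq> y \<and> f {x, y} = x"

lemma cut_relation_selection_less:
  assumes "Hausdorff_space X" "continuous_selection X f"
  shows "cut_relation X (selection_less f)"
proof
  have sel: "f S \<in> S" if "closedin X S" "S \<noteq> {}" for S
    using that assms(2)
    by (auto simp: continuous_selection_def selection_def nonempty_closed_sets_def)
  have pair: "f {x, y} = x \<or> f {x, y} = y" if "x \<in> topspace X" "y \<in> topspace X" for x y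
    using sel[of "{x, y}"] closedin_Hausdorff_finite[OF assms(1), of "{x, y}"] that by auto
  fix x y
  show "selection_less f x y \<Longrightarrow> \<not> selection_less f y x"
    by (auto simp: selection_less_def insert_commute)
  show "selection_less f x y \<or> selection_less f y x"
    if "x \<in> topspace X" "y \<in> topspace X" "x \<noteq> y"
    using pair[OF that(1,2)] that(3) by (auto simp: selection_less_def insert_commute)
  assume y: "y \<in> topspace X"
  \<comment> \<open>These are the selected points for the singleton \<open>{y}\<close>: the closed
    lower ray at \<open>y\<close>.\<close>
  let ?G = "{x \<in> topspace X. f {x, y} = x}"
  have cl: "closedin X {y}"
    using closedin_Hausdorff_singleton[OF assms(1) y] .
  have "f {y} = y"
    using sel[OF cl] by simp
  then have "{x \<in> topspace X. selection_less f x y} = ?G - {f {y}}"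
    by (auto simp: selection_less_def)
  then show "openin X {x \<in> topspace X. selection_less f x y}"
    using openin_selected_points[OF assms cl] by simp
  have "{x \<in> topspace X. selection_less f y x} = topspace X - ?G"
    using pair y \<open>f {y} = y\<close> by (auto simp: selection_less_def insert_commute)
  then show "openin X {x \<in> topspace X. selection_less f y x}"
    using closedin_selected_points[OF assms cl] by (simp add: openin_diff)
qed

section \<open>No selection point lies between points of a quasi-component\<close>

lemma selected_point_not_between:
  assumes X: "Hausdorff_space X" and f: "continuous_selection X f"
    and F: "closedin X F" "p \<in> F" "q \<in> F" "closedin X (F - {f F})"
    and Q: "quasi_component_of X p q"
    and less: "selection_less f p (f F)" "selection_less f (f F) q"
  shows False
proof -
  let ?s = "f F" and ?S = "F - {f F}"
  let ?G = "{x \<in> topspace X. f (insert x ?S) = x}"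
  interpret cut_relation X "selection_less f"
    using cut_relation_selection_less[OF X f] .
  have sel: "f S \<in> S" if "closedin X S" "S \<noteq> {}" for S
    using that f by (auto simp: continuous_selection_def selection_def nonempty_closed_sets_def)
  have s: "?s \<in> F" "?s \<in> topspace X"
    using sel[OF F(1)] F(2) closedin_subset[OF F(1)] by auto
  have pq: "p \<in> ?S" "q \<in> ?S"
    using F less irrefl by auto
  have c: "f ?S \<in> ?S" "f ?S \<in> topspace X"
    using sel[OF F(4)] pq closedin_subset[OF F(4)] by auto
  have clG: "closedin X ?G"
    by (rule closedin_selected_points[OF X f F(4)]) (use pq in auto)
  have opG: "openin X (?G - {f ?S})"
    by (rule openin_selected_points[OF X f F(4)]) (use pq in auto)
  have sG: "?s \<in> ?G"
    using s by (simp add: insert_absorb)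
  \<comment> \<open>Inserting a point of \<open>?S\<close> changes nothing, so \<open>f\<close>
    still picks \<open>f ?S\<close>.\<close>
  have notG: "x \<notin> ?G" if "x \<in> ?S" "x \<noteq> f ?S" for x
    using that insert_absorb[OF that(1)] by auto
  have ps: "quasi_component_of X p ?s"
    using quasi_component_of_between[OF Q s(2) less] .
  have qs: "quasi_component_of X q ?s"
    using Q ps by (meson quasi_component_of_sym quasi_component_of_trans)
  have "?s \<noteq> f ?S" using c(1) by auto
  then consider "selection_less f ?s (f ?S)" | "selection_less f (f ?S) ?s"
    using total s(2) c(2) by blast
  then show False
  proof cases
    \<comment> \<open>Asymmetry gives \<open>p \<noteq> f ?S\<close>, as \<open>p\<close> is below
      \<open>f F\<close> and \<open>f ?S\<close> above it. The other case is the mirror image with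
      \<open>q\<close>.\<close>
    case 1
    then have "p \<notin> ?G"
      using notG[OF pq(1)] less asym by metis
    then show False
      using cut_closed_open[OF clG opG sG _ c(2) 1 less(1)] ps by blast
  next
    case 2
    then have "q \<notin> ?G"
      using notG[OF pq(2)] less asym by metis
    then show False
      using cut_relation.cut_closed_open[OF dual clG opG sG _ c(2) 2 less(2)] qs by blast
  qed
qed

lemma selection_point_not_between:
  assumes X: "Hausdorff_space X" and f: "continuous_selection X f"
    and r: "f (topspace X) \<in> topspace X"
    and Q: "quasi_component_of X p q"
    and less: "selection_less f p (f (topspace X))" "selection_less f (f (topspace X)) q"
  shows False
proof -
  interpret cut_relation X "selection_less f"
    using cut_relation_selection_less[OF X f] .
  have pq: "p \<in> topspace X" "q \<in> topspace X"
    using Q by (auto simp: quasi_component_of_def)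
  let ?U = "{x \<in> topspace X. selection_less f p x} \<inter> {x \<in> topspace X. selection_less f x q}"
  let ?W = "{S \<in> topspace (vietoris_topology X). f S \<in> ?U}"
  have "openin X ?U"
    using open_above[OF pq(1)] open_below[OF pq(2)] by blast
  then have W: "openin (vietoris_topology X) ?W"
    using f openin_continuous_map_preimage unfolding continuous_selection_def by blast
  \<comment> \<open>The assumption \<open>r\<close> makes the whole space nonempty, hence a point of
    the hyperspace.\<close>
  have XW: "topspace X \<in> ?W"
    using less r by (auto simp: nonempty_closed_sets_def)
  obtain F where F: "finite F" "F \<subseteq> topspace X" "\<forall>S \<in> nonempty_closed_sets X. F \<subseteq> S \<longrightarrow> S \<in> ?W"
    using openin_vietoris_contains_supersets[OF W XW] by blast
  let ?F = "F \<union> {p, q}"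
  have cl: "closedin X ?F" "closedin X (?F - {f ?F})"
    using F(1,2) pq by (auto intro!: closedin_Hausdorff_finite[OF X])
  then have "?F \<in> ?W"
    using F(3) by (auto simp: nonempty_closed_sets_def)
  then show False
    using selected_point_not_between[OF X f cl(1) _ _ cl(2) Q] by auto
qed

theorem theorem3p1:
  fixes X :: "'a topology"
  assumes "Hausdorff_space X"
    and "infinite (topspace X)"
  shows "totally_disconnected_space (subtopology X (X closure_of (cs_points X)))"
proof (rule totally_disconnected_spaceI)
  let ?Y = "X closure_of (cs_points X)"
  fix x y assume xy: "quasi_component_of (subtopology X ?Y) x y"
  then have "x \<in> ?Y"
    by (auto simp: quasi_component_of_def)
  then have "cs_points X \<noteq> {}" by auto
  then obtain f where f: "continuous_selection X f"
    by (auto simp: cs_points_def)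
  have A: "cut_relation X (selection_less f)"
    using cut_relation_selection_less[OF assms(1) f] .
  \<comment> \<open>Stated for arbitrary \<open>p\<close> and \<open>q\<close> so that it serves
    both orders of \<open>x\<close> and \<open>y\<close>.\<close>
  have False if QY: "quasi_component_of (subtopology X ?Y) p q" and pq: "selection_less f p q" for p q
  proof -
    interpret cut_relation X "selection_less f" by (fact A)
    have Q: "quasi_component_of X p q"
      using quasi_component_of_subtopology[OF QY] .
    let ?U = "{x \<in> topspace X. selection_less f p x} \<inter> {x \<in> topspace X. selection_less f x q}"
    obtain z where z: "z \<in> topspace X" "selection_less f p z" "selection_less f z q"
      using quasi_component_between_nonempty[OF Q pq] .
    then have "z \<in> ?Y"
      using cut_subtopology QY by blast
    then have meet: "z \<in> T \<and> openin X T \<longrightarrow> (\<exists>r. r \<in> cs_points X \<and> r \<in> T)" for T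
      by (simp add: in_closure_of)
    have "openin X ?U"
      using Q open_above open_below by (auto simp: quasi_component_of_def)
    then have "\<exists>r. r \<in> cs_points X \<and> r \<in> ?U"
      using meet[of ?U] z by simp
    then obtain h r where h: "continuous_selection X h" "r = h (topspace X)" "r \<in> topspace X"
      and r: "selection_less f p r" "selection_less f r q"
      by (auto simp: cs_points_def)
    \<comment> \<open>The interval comes from \<open>f\<close> but \<open>r\<close> is selected by
      \<open>h\<close>, so betweenness must pass to the order of \<open>h\<close>, which may swap
      \<open>p\<close> and \<open>q\<close>.\<close>
    have "selection_less h p r \<and> selection_less h r q \<or> selection_less h q r \<and> selection_less h r p"
      using cut_relation_between[OF A cut_relation_selection_less[OF assms(1) h(1)] Q h(3) r] .
    moreover have "quasi_component_of X q p"
      using Q by (simp add: quasi_component_of_sym)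
    ultimately show False
      using selection_point_not_between[OF assms(1) h(1)] h(2,3) Q by metis
  qed
  then have "\<not> selection_less f x y" "\<not> selection_less f y x"
    using xy quasi_component_of_sym by metis+
  moreover have "x \<in> topspace X" "y \<in> topspace X"
    using quasi_component_of_subtopology[OF xy] by (auto simp: quasi_component_of_def)
  ultimately show "x = y"
    using cut_relation.total[OF A] by blast
qed

end
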